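(* Let $w^\star(x,t)$ be the exact solution of the periodic advection problem $$w_t+\lambda w_x=0 \ \text{ on } [0,L]\times[0,T],\qquad w(0,t)=w(L,t)\ \text{ for } t\in[0,T],\qquad w(x,0)=w_0(x)\ \text{ for } x\in[0,L],$$ with $C^p$ initial condition in the sense that $w_0^{\mathrm{ext}}\in C^p(\mathbb{R})$, where $w_0^{\mathrm{ext}}$ is the $L$-periodic extension of $w_0$, and assume $p\ge 3$. For a positive integer $N$ and $h=L/N$, let $w_j(t)$ and $\overline{w}_{j+1/2}(t)$ be the solutions of the semi-discretized hybrid-variable ODE system $$\overline{w}_{j+1/2}'+\frac{\lambda}{h}(w_{j+1}-w_j)=0,\qquad w_j'+\frac{\lambda}{h}\left(w_{j-1}-\frac72\overline{w}_{j-1/2}+2w_j+\frac12\overline{w}_{j+1/2}\right)=0,\qquad \forall j,\ t\in[0,T],$$ with exact initial data $$w_j(0)=w^\star(x_j,0),\qquad \overline{w}_{j+1/2}(0)=\frac1h\int_{x_j}^{x_{j+1}}w^\star(x,0)\,dx .$$ Then for any $\varepsilon>0$ there exists a constant $C>0$ that depends only on $L$, $T$, $\lambda$, $w_0$, and $\varepsilon$ (in particular, not on $N$ or $j$), such that for all $j$: $$|w_j(T)-w^\star(x_j,T)|\le Ch^4+\varepsilon\quad\text{and}\quad \left|\overline{w}_{j+1/2}(T)-\frac1h\int_{x_j}^{x_{j+1}}w^\star(x,T)\,dx\right|\le Ch^4+\varepsilon .$$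
   Context: Here $L>0$, $T>0$, and $\lambda>0$ is a constant advection velocity. The interval $[0,L]$ is divided into $N$ uniform cells $[x_j,x_{j+1}]$, $0\le j\le N-1$, with $x_j=jh$ and $h=L/N$. The unknowns are the nodal values $w_j(t)$ and the cell-averaged values $\overline{w}_{j+1/2}(t)$, with the periodic index convention $w_j=w_{j+N}$ and $\overline{w}_{j+1/2}=\overline{w}_{j+N+1/2}$. *)

theory Defs
  imports "HOL-Analysis.Analysis" "HOL-Library.Real_Mod"
begin

definition Cp_real :: "nat \<Rightarrow> (real \<Rightarrow> real) \<Rightarrow> bool" where
  "Cp_real p f \<longleftrightarrow>
     (\<forall>k<p. \<forall>x. (deriv ^^ k) f differentiable (at x)) \<and>
     continuous_on UNIV ((deriv ^^ p) f)"

text \<open>The representative of \<open>x\<close> modulo \<open>L\<close> is taken in \<open>[0, L)\<close>; a profile with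
  \<open>f 0 \<noteq> f L\<close>, which has no periodic extension, is excluded below by the boundary
  condition at time \<open>0\<close>.\<close>

definition periodic_ext :: "real \<Rightarrow> (real \<Rightarrow> real) \<Rightarrow> real \<Rightarrow> real" where
  "periodic_ext L f x = f (x rmod L)"

text \<open>Classical solutions on the closed rectangle: the two partial derivatives are taken within
  the intervals, so they are one-sided at the end points. Differentiability is meant jointly in
  \<open>(x, t)\<close>, because the mere existence of the partial derivatives is not an adequate
  notion of solution.\<close>

definition advection_solution ::
  "real \<Rightarrow> real \<Rightarrow> real \<Rightarrow> (real \<Rightarrow> real) \<Rightarrow> (real \<Rightarrow> real \<Rightarrow> real) \<Rightarrow> bool" where
  "advection_solution L T lam w0 w \<longleftrightarrow>
     (\<lambda>(x, t). w x t) differentiable_on ({0..L} \<times> {0..T}) \<and>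
     (\<forall>x\<in>{0..L}. \<forall>t\<in>{0..T}. \<exists>wt wx.
        ((\<lambda>s. w x s) has_real_derivative wt) (at t within {0..T}) \<and>
        ((\<lambda>y. w y t) has_real_derivative wx) (at x within {0..L}) \<and>
        wt + lam * wx = 0) \<and>
     (\<forall>t\<in>{0..T}. w 0 t = w L t) \<and>
     (\<forall>x\<in>{0..L}. w x 0 = w0 x)"

definition mesh :: "real \<Rightarrow> nat \<Rightarrow> real" where
  "mesh L N = L / real N"

definition node :: "real \<Rightarrow> nat \<Rightarrow> int \<Rightarrow> real" where
  "node L N j = of_int j * mesh L N"

definition cell_average :: "real \<Rightarrow> nat \<Rightarrow> (real \<Rightarrow> real) \<Rightarrow> int \<Rightarrow> real" where
  "cell_average L N f j = 1 / mesh L N * integral {node L N j .. node L N (j + 1)} f"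

text \<open>\<open>v j t\<close> is the nodal value at the \<open>j\<close>-th node and \<open>vbar j t\<close> the
  averaged value on the cell between the nodes \<open>j\<close> and \<open>j + 1\<close>, so that
  \<open>vbar (j - 1)\<close> carries the half-integer index \<open>j - 1/2\<close>.\<close>

definition hybrid_variable_solution ::
  "real \<Rightarrow> real \<Rightarrow> real \<Rightarrow> nat \<Rightarrow> (int \<Rightarrow> real \<Rightarrow> real) \<Rightarrow> (int \<Rightarrow> real \<Rightarrow> real) \<Rightarrow> bool" where
  "hybrid_variable_solution L T lam N v vbar \<longleftrightarrow>
     (\<forall>j. \<forall>t\<in>{0..T}. v (j + int N) t = v j t \<and> vbar (j + int N) t = vbar j t) \<and>
     (\<forall>j. \<forall>t\<in>{0..T}.
        (vbar j has_real_derivative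
           - (lam / mesh L N * (v (j + 1) t - v j t))) (at t within {0..T}) \<and>
        (v j has_real_derivative
           - (lam / mesh L N *
              (v (j - 1) t - 7 / 2 * vbar (j - 1) t + 2 * v j t + 1 / 2 * vbar j t)))
          (at t within {0..T}))"

definition exact_initial_data ::
  "real \<Rightarrow> nat \<Rightarrow> (real \<Rightarrow> real \<Rightarrow> real) \<Rightarrow> (int \<Rightarrow> real \<Rightarrow> real) \<Rightarrow> (int \<Rightarrow> real \<Rightarrow> real) \<Rightarrow> bool" where
  "exact_initial_data L N w v vbar \<longleftrightarrow>
     (\<forall>j\<in>{0..<int N}.
        v j 0 = w (node L N j) 0 \<and> vbar j 0 = cell_average L N (\<lambda>x. w x 0) j)"

end

theory Submission
  imports Defs
begin

text \<open>The error estimate rests on stability, consistency and smoothing, all carried out in physical space without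
Fourier analysis.

Stability. The spatial operator of the scheme has a first-order physical mode and a damped spurious mode, but
the physical mode is dissipated only at sixth order in the wave number. A weighted sum of the squares of the
nodal values and cell means is not monotone for any weights, as constant data with different nodal and cell
values show. The quadratic form \<open>hv_energy\<close> couples each nodal value with the two adjacent cell means such that
its derivative along the scheme is a flux difference minus two squares
(\<open>hv_energy_deriv_eq_flux_difference\<close>). Summing over a period gives an estimate in the quadratic mean with a
constant independent of \<open>N\<close> (\<open>hv_stability\<close>). Differences of a solution are again solutions, so a discrete
Sobolev inequality turns this into a bound in the maximum norm (\<open>hv_sup_stability\<close>).

Consistency. Inserting exact nodal values and means of a smooth profile \<open>u\<close> leaves a residual
\<open>\<lambda> h^3/60 w\<close>, \<open>w\<close> being the fourth derivative of \<open>u\<close>, in the nodal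
equation, which is one order short. Replacing the nodal values by those of
\<open>u - h^4/180 w\<close> removes this term and disturbs the cell equation by \<open>O(h^4)\<close> only
(\<open>hv_node_residual_le\<close>, \<open>hv_cell_residual_le\<close>). This is the reason for the fourth-order convergence.

Smoothing. The initial profile is only known to have three continuous derivatives, while the two previous steps use six. It
is replaced by its threefold Steklov mean, which is periodic, has six continuous derivatives and is close to it
in \<open>C^1\<close> (\<open>smooth_periodic_approximation\<close>). By stability the difference contributes at most a
fixed multiple of its size, which is made at most \<open>\<epsilon>\<close>; the constant \<open>C\<close> depends on the chosen mean and
thus on \<open>\<epsilon>\<close>. Finally, the method of characteristics identifies the exact solution as the periodic extension
of the initial profile at \<open>x - \<lambda> t\<close> (\<open>advection_solution_eq\<close>).\<close>

section \<open>A quadratic energy for the hybrid-variable scheme\<close>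

lemma sum_int_telescope:
  fixes F :: "int \<Rightarrow> real"
  shows "(\<Sum>j\<in>{0..<int n}. F (j + 1) - F j) = F (int n) - F 0"
proof (induction n)
  case 0
  then show ?case by simp
next
  case (Suc n)
  have "{0..<int (Suc n)} = insert (int n) {0..<int n}" by auto
  with Suc show ?case by (simp add: algebra_simps)
qed

text \<open>The energy density at node \<open>j\<close> is evaluated at \<open>a = v\<^sub>j\<close>, \<open>bm\<close> the mean over the cell to the left of the node
and \<open>b\<close> the mean over the cell to its right. Its sum over one period does not increase along solutions of
the unforced scheme.\<close>
definition hv_energy :: "real \<Rightarrow> real \<Rightarrow> real \<Rightarrow> real" where
  "hv_energy a bm b = 4 * (a - bm)\<^sup>2 + 2 * (a - b)\<^sup>2 + 3 * b\<^sup>2 + (b - bm)\<^sup>2"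

text \<open>The time derivative of the energy density when the three arguments have time derivatives \<open>a'\<close>,
\<open>bm'\<close>, \<open>b'\<close>; as a bilinear form this is twice the polarization of \<open>hv_energy\<close>.\<close>
definition hv_energy_deriv :: "real \<Rightarrow> real \<Rightarrow> real \<Rightarrow> real \<Rightarrow> real \<Rightarrow> real \<Rightarrow> real" where
  "hv_energy_deriv a bm b a' bm' b' =
     8 * (a - bm) * (a' - bm') + 4 * (a - b) * (a' - b') + 6 * b * b' + 2 * (b - bm) * (b' - bm')"

text \<open>The flux that makes the energy balance below a pointwise identity; \<open>am\<close> and \<open>bmm\<close> are the nodal value and
the cell mean one position further to the left than \<open>a\<close> and \<open>bm\<close>. It is obtained by shifting every product
in the balance to a normal position.\<close>
definition hv_flux :: "real \<Rightarrow> real \<Rightarrow> real \<Rightarrow> real \<Rightarrow> real \<Rightarrow> real" where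
  "hv_flux am a bmm bm b =
     20 * am * a - 18 * am * bm - 2 * am * b + 32/5 * a * a - 6/5 * a * bmm - 36 * a * bm
     - 8/5 * a * b - 1/10 * bmm * bmm + bmm * bm + 2/5 * bmm * b + 25 * bm * bm + 3 * bm * b
     + 1/10 * b * b"

text \<open>The dissipation identity. In rescaled time the scheme reads \<open>b' = - (ap - a)\<close> and
\<open>a' = - (am + 2 a - 7/2 bm + 1/2 b)\<close>. The term \<open>(2 b + 5 bm - bmm) / 6\<close> is the third-order upwind
reconstruction of the nodal value from cell means, so that the second square damps the spurious mode, while
the first square contains the third difference of the means and vanishes to third order on smooth grid
functions. On the Fourier side the energy and the dissipation are Hermitian forms with trigonometric
polynomial entries, and both are positive semidefinite at every frequency.\<close>
lemma hv_energy_deriv_eq_flux_difference: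
  "hv_energy_deriv a bm b
       (- (am + 2 * a - 7/2 * bm + 1/2 * b)) (- (a - am)) (- (ap - a))
     = (hv_flux a ap bm b bp - hv_flux am a bmm bm b)
       - 5/18 * ((bp - 3 * b + 3 * bm - bmm) + 24/5 * (ap - (2 * bp + 5 * b - bm) / 6)
            + 6 * (a - (2 * b + 5 * bm - bmm) / 6))\<^sup>2
       - 18/5 * (a - (2 * b + 5 * bm - bmm) / 6)\<^sup>2"
  unfolding hv_energy_deriv_def hv_flux_def power2_eq_square
  by (simp add: field_simps)

lemma hv_energy_deriv_le_flux_difference:
  "hv_energy_deriv a bm b
       (- (am + 2 * a - 7/2 * bm + 1/2 * b)) (- (a - am)) (- (ap - a))
     \<le> hv_flux a ap bm b bp - hv_flux am a bmm bm b"
proof -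
  have "0 \<le> ((bp - 3 * b + 3 * bm - bmm) + 24/5 * (ap - (2 * bp + 5 * b - bm) / 6)
            + 6 * (a - (2 * b + 5 * bm - bmm) / 6))\<^sup>2"
    "0 \<le> (a - (2 * b + 5 * bm - bmm) / 6)\<^sup>2" by simp_all
  then show ?thesis
    unfolding hv_energy_deriv_eq_flux_difference[where bmm = bmm and bp = bp] by linarith
qed

lemma hv_energy_deriv_le:
  "hv_energy_deriv a bm b a' bm' b' \<le> hv_energy a bm b + hv_energy a' bm' b'"
proof -
  have "hv_energy a bm b + hv_energy a' bm' b' - hv_energy_deriv a bm b a' bm' b'
      = hv_energy (a - a') (bm - bm') (b - b')"
    unfolding hv_energy_def hv_energy_deriv_def by (simp add: power2_eq_square algebra_simps)
  moreover have "hv_energy (a - a') (bm - bm') (b - b') \<ge> 0"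
    by (simp add: hv_energy_def)
  ultimately show ?thesis by linarith
qed

lemma hv_energy_deriv_linear:
  "hv_energy_deriv a bm b (k * a1 + a2) (k * b1 + b2) (k * c1 + c2)
     = k * hv_energy_deriv a bm b a1 b1 c1 + hv_energy_deriv a bm b a2 b2 c2"
  unfolding hv_energy_deriv_def by (simp add: algebra_simps)

lemma power2_le_hv_energy: "a\<^sup>2 \<le> hv_energy a bm b" "b\<^sup>2 \<le> hv_energy a bm b"
proof -
  have "hv_energy a bm b - a\<^sup>2 = 4 * (a - bm)\<^sup>2 + (a - 2 * b)\<^sup>2 + b\<^sup>2 + (b - bm)\<^sup>2"
    unfolding hv_energy_def by (simp add: power2_eq_square algebra_simps)
  moreover have "0 \<le> 4 * (a - bm)\<^sup>2 + (a - 2 * b)\<^sup>2 + b\<^sup>2 + (b - bm)\<^sup>2" by simp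
  ultimately show "a\<^sup>2 \<le> hv_energy a bm b" by linarith
  show "b\<^sup>2 \<le> hv_energy a bm b"
    unfolding hv_energy_def by (simp add: add_nonneg_nonneg add_increasing)
qed

lemma hv_energy_le:
  assumes "\<bar>a\<bar> \<le> M" "\<bar>bm\<bar> \<le> M" "\<bar>b\<bar> \<le> M"
  shows "hv_energy a bm b \<le> 31 * M\<^sup>2"
proof -
  have sq: "x\<^sup>2 \<le> c * M\<^sup>2" if "\<bar>x\<bar> \<le> r * M" "c = r\<^sup>2" for x r c
    using power_mono[of "\<bar>x\<bar>" "r * M" 2] that by (simp add: power_mult_distrib)
  have "(a - bm)\<^sup>2 \<le> 4 * M\<^sup>2" "(a - b)\<^sup>2 \<le> 4 * M\<^sup>2" "(b - bm)\<^sup>2 \<le> 4 * M\<^sup>2"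
    by (rule sq[where r = 2]; use assms in simp)+
  moreover have "b\<^sup>2 \<le> 1 * M\<^sup>2" by (rule sq[where r = 1]; use assms in simp)
  ultimately show ?thesis unfolding hv_energy_def by linarith
qed

lemma gronwall_within:
  fixes E E' :: "real \<Rightarrow> real"
  assumes T: "0 \<le> T" and K: "0 \<le> K"
    and der: "\<And>t. t \<in> {0..T} \<Longrightarrow> (E has_real_derivative E' t) (at t within {0..T})"
    and le: "\<And>t. t \<in> {0..T} \<Longrightarrow> E' t \<le> E t + K"
  shows "E T \<le> exp T * (E 0 + T * K)"
proof -
  define G where "G t = exp (- t) * E t - K * t" for t
  have dG: "(G has_real_derivative (exp (- t) * (E' t - E t) - K)) (at t within {0..T})"
    if "t \<in> {0..T}" for t
    unfolding G_def
    by (rule derivative_eq_intros der that refl | simp add: algebra_simps)+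
  have "\<exists>x\<in>{0..T}. G T - G 0 = (exp (- x) * (E' x - E x) - K) * (T - 0)"
    using mvt_very_simple[of 0 T G "\<lambda>x. (*) (exp (- x) * (E' x - E x) - K)"] T dG
    by (auto simp: has_field_derivative_def)
  then obtain x where x: "x \<in> {0..T}"
    and eq: "G T - G 0 = (exp (- x) * (E' x - E x) - K) * (T - 0)" by blast
  have "exp (- x) * (E' x - E x) \<le> exp (- x) * K"
    using le[OF x] by (intro mult_left_mono) auto
  also have "\<dots> \<le> 1 * K" using x K by (intro mult_right_mono) auto
  finally have "(exp (- x) * (E' x - E x) - K) * (T - 0) \<le> 0"
    using T by (intro mult_nonpos_nonneg) auto
  then have "exp (- T) * E T \<le> E 0 + T * K"
    using eq by (simp add: G_def algebra_simps)
  then have "exp T * (exp (- T) * E T) \<le> exp T * (E 0 + T * K)"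
    by (intro mult_left_mono) auto
  then show ?thesis by (simp add: mult.assoc[symmetric] exp_minus)
qed

text \<open>Stability in the quadratic mean, uniformly in \<open>N\<close> and in the factor \<open>\<kappa>\<close>, which is \<open>\<lambda>/h\<close> in the application.\<close>
lemma hv_stability:
  fixes a b f g :: "int \<Rightarrow> real \<Rightarrow> real"
  assumes T: "0 \<le> T" and kap: "0 \<le> \<kappa>"
    and per: "\<And>j t. t \<in> {0..T} \<Longrightarrow> a (j + int N) t = a j t"
             "\<And>j t. t \<in> {0..T} \<Longrightarrow> b (j + int N) t = b j t"
    and da: "\<And>j t. t \<in> {0..T} \<Longrightarrow> (a j has_real_derivative
        - (\<kappa> * (a (j - 1) t - 7/2 * b (j - 1) t + 2 * a j t + 1/2 * b j t)) + f j t)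
        (at t within {0..T})"
    and db: "\<And>j t. t \<in> {0..T} \<Longrightarrow> (b j has_real_derivative
        - (\<kappa> * (a (j + 1) t - a j t)) + g j t) (at t within {0..T})"
    and f: "\<And>j t. t \<in> {0..T} \<Longrightarrow> \<bar>f j t\<bar> \<le> K" and g: "\<And>j t. t \<in> {0..T} \<Longrightarrow> \<bar>g j t\<bar> \<le> K"
    and a0: "\<And>j. \<bar>a j 0\<bar> \<le> M" and b0: "\<And>j. \<bar>b j 0\<bar> \<le> M"
  shows "(\<Sum>j\<in>{0..<int N}. hv_energy (a j T) (b (j - 1) T) (b j T))
       \<le> exp T * 31 * real N * (M\<^sup>2 + T * K\<^sup>2)"
proof -
  define E where "E t = (\<Sum>j\<in>{0..<int N}. hv_energy (a j t) (b (j - 1) t) (b j t))" for t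
  define a' where "a' j t = - (\<kappa> * (a (j - 1) t - 7/2 * b (j - 1) t + 2 * a j t + 1/2 * b j t)) + f j t" for j t
  define b' where "b' j t = - (\<kappa> * (a (j + 1) t - a j t)) + g j t" for j t
  define E' where "E' t = (\<Sum>j\<in>{0..<int N}. hv_energy_deriv (a j t) (b (j - 1) t) (b j t)
      (a' j t) (b' (j - 1) t) (b' j t))" for t
  have dE: "(E has_real_derivative E' t) (at t within {0..T})" if t: "t \<in> {0..T}" for t
  proof -
    note d = da[OF t, folded a'_def] db[OF t, folded b'_def]
    show ?thesis
      unfolding E_def E'_def hv_energy_def hv_energy_deriv_def
      by (rule derivative_eq_intros d refl | simp add: algebra_simps)+
  qed
  have E'_le: "E' t \<le> E t + 31 * real N * K\<^sup>2" if t: "t \<in> {0..T}" for t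
  proof -
    define F where "F j = hv_flux (a (j - 1) t) (a j t) (b (j - 2) t) (b (j - 1) t) (b j t)" for j
    have "hv_energy_deriv (a j t) (b (j - 1) t) (b j t) (a' j t) (b' (j - 1) t) (b' j t)
        \<le> \<kappa> * (F (j + 1) - F j) + (hv_energy (a j t) (b (j - 1) t) (b j t) + 31 * K\<^sup>2)" for j
    proof -
      let ?D = "hv_energy_deriv (a j t) (b (j - 1) t) (b j t)"
      have "?D (a' j t) (b' (j - 1) t) (b' j t) = \<kappa> * ?D
          (- (a (j - 1) t + 2 * a j t - 7/2 * b (j - 1) t + 1/2 * b j t))
          (- (a j t - a (j - 1) t)) (- (a (j + 1) t - a j t))
          + ?D (f j t) (g (j - 1) t) (g j t)"
        unfolding hv_energy_deriv_linear[symmetric] by (simp add: a'_def b'_def algebra_simps)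
      moreover have "?D (- (a (j - 1) t + 2 * a j t - 7/2 * b (j - 1) t + 1/2 * b j t))
          (- (a j t - a (j - 1) t)) (- (a (j + 1) t - a j t)) \<le> F (j + 1) - F j"
        using hv_energy_deriv_le_flux_difference[of "a j t" "b (j - 1) t" "b j t" "a (j - 1) t"
            "a (j + 1) t" "b (j + 1) t" "b (j - 2) t"]
        by (simp add: F_def)
      then have "\<kappa> * ?D (- (a (j - 1) t + 2 * a j t - 7/2 * b (j - 1) t + 1/2 * b j t))
          (- (a j t - a (j - 1) t)) (- (a (j + 1) t - a j t)) \<le> \<kappa> * (F (j + 1) - F j)"
        using kap by (rule mult_left_mono)
      moreover have "?D (f j t) (g (j - 1) t) (g j t)
          \<le> hv_energy (a j t) (b (j - 1) t) (b j t) + 31 * K\<^sup>2"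
        using hv_energy_deriv_le[of "a j t" "b (j - 1) t" "b j t" "f j t" "g (j - 1) t" "g j t"]
          hv_energy_le[OF f[OF t] g[OF t] g[OF t], of j "j - 1" j] by linarith
      ultimately show ?thesis by linarith
    qed
    then have "E' t \<le> (\<Sum>j\<in>{0..<int N}. \<kappa> * (F (j + 1) - F j)
        + (hv_energy (a j t) (b (j - 1) t) (b j t) + 31 * K\<^sup>2))"
      unfolding E'_def by (intro sum_mono)
    also have "\<dots> = \<kappa> * (F (int N) - F 0) + (E t + 31 * real N * K\<^sup>2)"
      by (simp add: sum.distrib sum_distrib_left[symmetric] sum_int_telescope E_def)
    also have "F (int N) = F 0"
      using per(1)[OF t, of 0] per(1)[OF t, of "-1"] per(2)[OF t, of 0] per(2)[OF t, of "-1"]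
        per(2)[OF t, of "-2"] by (simp add: F_def)
    finally show ?thesis by simp
  qed
  have "E T \<le> exp T * (E 0 + T * (31 * real N * K\<^sup>2))"
    by (rule gronwall_within[OF T _ dE E'_le]) auto
  also have "E 0 \<le> 31 * real N * M\<^sup>2"
    unfolding E_def
    using sum_bounded_above[of "{0..<int N}" "\<lambda>j. hv_energy (a j 0) (b (j - 1) 0) (b j 0)" "31 * M\<^sup>2"]
      hv_energy_le[OF a0 b0 b0] by (simp add: mult_ac)
  finally show ?thesis
    by (simp add: E_def algebra_simps)
qed

text \<open>Some value is at most the bound \<open>A\<close> on the quadratic mean, and by the Cauchy-Schwarz inequality the variation over the
\<open>N\<close> steps is at most \<open>N\<close> times the bound \<open>B\<close> on the quadratic mean of the differences.\<close>
lemma discrete_sobolev: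
  fixes x :: "int \<Rightarrow> real"
  assumes N: "0 < N" and A: "0 \<le> A" and B: "0 \<le> B"
    and sA: "(\<Sum>j\<in>{0..<int N}. (x j)\<^sup>2) \<le> real N * A\<^sup>2"
    and sB: "(\<Sum>j\<in>{0..<int N}. (x (j + 1) - x j)\<^sup>2) \<le> real N * B\<^sup>2"
    and i: "i \<in> {0..<int N}"
  shows "\<bar>x i\<bar> \<le> A + real N * B"
proof -
  have "\<exists>k\<in>{0..<int N}. \<bar>x k\<bar> \<le> A"
  proof (rule ccontr)
    assume none: "\<not> ?thesis"
    have "A\<^sup>2 < (x k)\<^sup>2" if "k \<in> {0..<int N}" for k
    proof -
      have "A < \<bar>x k\<bar>" using none that by (auto simp: not_le)
      then show ?thesis using A power_strict_mono[of A "\<bar>x k\<bar>" 2] by simp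
    qed
    then have "(\<Sum>j\<in>{0..<int N}. A\<^sup>2) < (\<Sum>j\<in>{0..<int N}. (x j)\<^sup>2)"
      using N by (intro sum_strict_mono) auto
    with sA show False by simp
  qed
  then obtain k where k: "k \<in> {0..<int N}" "\<bar>x k\<bar> \<le> A" by blast
  let ?V = "\<Sum>j\<in>{0..<int N}. \<bar>x (j + 1) - x j\<bar>"
  have walk: "\<bar>x q - x p\<bar> \<le> ?V" if "0 \<le> p" "p \<le> q" "q \<le> int N" for p q
  proof -
    have "\<bar>x q - x p\<bar> \<le> (\<Sum>j\<in>{p..<q}. \<bar>x (j + 1) - x j\<bar>)"
      using \<open>p \<le> q\<close>
    proof (induction q rule: int_ge_induct)
      case base
      then show ?case by simp
    next
      case (step q)
      have "{p..<q + 1} = insert q {p..<q}" using step.hyps by auto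
      with step.IH show ?case by simp
    qed
    also have "\<dots> \<le> ?V" using that by (intro sum_mono2) auto
    finally show ?thesis .
  qed
  have "\<bar>x i - x k\<bar> \<le> ?V"
    using walk[of i k] walk[of k i] i k by (cases "i \<le> k") (auto simp: abs_minus_commute)
  moreover have "?V\<^sup>2 \<le> (real N * B)\<^sup>2"
  proof -
    have "?V\<^sup>2 \<le> real N * (\<Sum>j\<in>{0..<int N}. (x (j + 1) - x j)\<^sup>2)"
      using sum_squared_le_sum_of_squares[of "\<lambda>j. \<bar>x (j + 1) - x j\<bar>" "{0..<int N}"]
      by (simp add: mult.commute)
    also have "\<dots> \<le> real N * (real N * B\<^sup>2)" using sB by (intro mult_left_mono) auto
    finally show ?thesis by (simp add: power_mult_distrib power2_eq_square mult_ac)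
  qed
  then have "?V \<le> real N * B"
    using B by (auto intro: power2_le_imp_le)
  ultimately show ?thesis using k by linarith
qed

section \<open>Smoothing of periodic functions\<close>

text \<open>Iterated derivatives as data: \<open>c k\<close> is the \<open>k\<close>-th derivative of \<open>c 0\<close> for all \<open>k \<le> n\<close>. A smooth
profile is represented below by a chain in which \<open>c 1\<close> is the profile and \<open>c 0\<close> an antiderivative of it,
because cell means are difference quotients of the antiderivative.\<close>
definition derivative_chain :: "nat \<Rightarrow> (nat \<Rightarrow> real \<Rightarrow> real) \<Rightarrow> bool" where
  "derivative_chain n c \<longleftrightarrow> (\<forall>k<n. \<forall>x. (c k has_real_derivative c (Suc k) x) (at x))"

lemma continuous_antiderivative:
  fixes g :: "real \<Rightarrow> real"
  assumes "continuous_on UNIV g"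
  obtains G where "\<And>x. (G has_real_derivative g x) (at x)"
proof -
  have "isCont g x" for x using assms by (simp add: continuous_on_eq_continuous_at)
  then show ?thesis
    using einterval_antiderivative[of "-\<infinity>" "\<infinity>" g] that
    by (auto simp: has_real_derivative_iff_has_vector_derivative)
qed

lemma integral_eq_antiderivative:
  fixes g :: "real \<Rightarrow> real"
  assumes "\<And>x. (G has_real_derivative g x) (at x)" and "a \<le> b"
  shows "integral {a..b} g = G b - G a"
  using assms
  by (intro integral_unique fundamental_theorem_of_calculus)
     (auto simp: has_real_derivative_iff_has_vector_derivative intro: has_vector_derivative_at_within)

text \<open>Forward difference quotient; applied to an antiderivative of \<open>g\<close> with the mesh size as step, it gives the cell means of \<open>g\<close>.\<close>
definition diff_quot :: "real \<Rightarrow> (real \<Rightarrow> real) \<Rightarrow> real \<Rightarrow> real" where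
  "diff_quot \<delta> g x = (g (x + \<delta>) - g x) / \<delta>"

text \<open>Steklov mean: the average of \<open>g\<close> over the interval of length \<open>\<delta>\<close> to the right of \<open>x\<close>.\<close>
definition steklov :: "real \<Rightarrow> (real \<Rightarrow> real) \<Rightarrow> real \<Rightarrow> real" where
  "steklov \<delta> g x = 1 / \<delta> * integral {x..x + \<delta>} g"

lemma steklov_eq_diff_quot:
  assumes "\<And>x. (G has_real_derivative g x) (at x)" and "0 < \<delta>"
  shows "steklov \<delta> g = diff_quot \<delta> G"
  using integral_eq_antiderivative[OF assms(1)] assms(2)
  by (auto simp: steklov_def diff_quot_def)

lemma diff_quot_deriv:
  assumes "\<And>x. (g has_real_derivative g' x) (at x)"
  shows "(diff_quot \<delta> g has_real_derivative diff_quot \<delta> g' x) (at x)"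
  unfolding diff_quot_def[abs_def]
  using DERIV_cdivide[OF DERIV_diff[OF iffD1[OF DERIV_shift assms[of "x + \<delta>"]] assms[of x]], of \<delta>]
  by simp

lemma steklov_deriv_diff_quot:
  assumes "continuous_on UNIV g" and "0 < \<delta>"
  shows "(steklov \<delta> g has_real_derivative diff_quot \<delta> g x) (at x)"
proof -
  obtain G where G: "\<And>x. (G has_real_derivative g x) (at x)"
    using continuous_antiderivative[OF assms(1)] by blast
  show ?thesis unfolding steklov_eq_diff_quot[OF G assms(2)] by (rule diff_quot_deriv[OF G])
qed

lemma steklov_deriv:
  assumes "\<And>x. (g has_real_derivative g' x) (at x)" and "0 < \<delta>"
  shows "(steklov \<delta> g has_real_derivative steklov \<delta> g' x) (at x)"
proof -
  have "continuous_on UNIV g" using assms(1) by (meson DERIV_continuous_on)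
  from steklov_deriv_diff_quot[OF this assms(2)] show ?thesis
    unfolding steklov_eq_diff_quot[OF assms] .
qed

lemma continuous_on_steklov:
  assumes "continuous_on UNIV g" and "0 < \<delta>"
  shows "continuous_on UNIV (steklov \<delta> g)"
  using steklov_deriv_diff_quot[OF assms] by (meson DERIV_continuous_on)

lemma continuous_on_diff_quot:
  assumes "continuous_on UNIV g"
  shows "continuous_on UNIV (diff_quot \<delta> g)"
  unfolding diff_quot_def[abs_def] divide_inverse
  by (intro continuous_intros continuous_on_compose2[OF assms]) auto

lemma steklov_mean_value:
  assumes "continuous_on UNIV g" and "0 < \<delta>"
  obtains \<xi> where "x < \<xi>" "\<xi> < x + \<delta>" "steklov \<delta> g x = g \<xi>"
proof -
  obtain G where G: "\<And>x. (G has_real_derivative g x) (at x)"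
    using continuous_antiderivative[OF assms(1)] by blast
  obtain z where "x < z" "z < x + \<delta>" "G (x + \<delta>) - G x = (x + \<delta> - x) * g z"
    using MVT2[of x "x + \<delta>" G g] G assms(2) by auto
  then show ?thesis
    using that[of z] assms(2) by (simp add: steklov_eq_diff_quot[OF G assms(2)] diff_quot_def)
qed

lemma abs_steklov_le:
  assumes "continuous_on UNIV g" "0 < \<delta>" "\<And>x. \<bar>g x\<bar> \<le> M"
  shows "\<bar>steklov \<delta> g x\<bar> \<le> M"
  using steklov_mean_value[OF assms(1,2), of x] assms(3) by metis

lemma abs_steklov_minus_le:
  assumes d: "\<And>x. (g has_real_derivative g' x) (at x)" and \<delta>: "0 < \<delta>" and M: "\<And>x. \<bar>g' x\<bar> \<le> M"
  shows "\<bar>steklov \<delta> g x - g x\<bar> \<le> \<delta> * M"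
proof -
  have cg: "continuous_on UNIV g" using d by (meson DERIV_continuous_on)
  obtain z where z: "x < z" "z < x + \<delta>" "steklov \<delta> g x = g z"
    using steklov_mean_value[OF cg \<delta>] .
  have "\<bar>g z - g x\<bar> \<le> M * \<bar>z - x\<bar>"
    using field_differentiable_bound[of UNIV g g' M z x] d M by auto
  also have "\<dots> \<le> M * \<delta>" using z M[of 0] by (intro mult_left_mono) auto
  finally show ?thesis by (simp add: z mult.commute)
qed

lemma abs_steklov3_minus_le:
  assumes d: "\<And>x. (g has_real_derivative g' x) (at x)" and c: "continuous_on UNIV g'"
    and \<delta>: "0 < \<delta>" and M: "\<And>x. \<bar>g' x\<bar> \<le> M"
  shows "\<bar>steklov \<delta> (steklov \<delta> (steklov \<delta> g)) x - g x\<bar> \<le> 3 * \<delta> * M"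
proof -
  let ?S = "steklov \<delta>"
  note d1 = steklov_deriv[OF d \<delta>] and b1 = abs_steklov_le[OF c \<delta> M]
  note d2 = steklov_deriv[OF d1 \<delta>]
    and b2 = abs_steklov_le[OF continuous_on_steklov[OF c \<delta>] \<delta> b1]
  show ?thesis
    using abs_steklov_minus_le[OF d \<delta> M, of x] abs_steklov_minus_le[OF d1 \<delta> b1, of x]
      abs_steklov_minus_le[OF d2 \<delta> b2, of x] by linarith
qed

lemma periodic_steklov:
  assumes "\<And>x. g (x + L) = (g x :: real)"
  shows "steklov \<delta> g (x + L) = steklov \<delta> g x"
proof -
  have "integral {x + L..x + L + \<delta>} g = integral {x..x + \<delta>} g"
    using integral_shift_real_ivl[of "x + L" L "x + L + \<delta>" g] assms by (simp add: algebra_simps)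
  then show ?thesis by (simp add: steklov_def)
qed

lemma periodic_deriv:
  fixes g :: "real \<Rightarrow> real"
  assumes d: "\<And>x. (g has_real_derivative g' x) (at x)" and p: "\<And>x. g (x + L) = g x"
  shows "g' (x + L) = g' x"
proof -
  have "((\<lambda>x. g (x + L)) has_real_derivative g' (x + L)) (at x)"
    using d[of "x + L"] by (simp add: DERIV_shift)
  then show ?thesis using p d[of x] DERIV_unique by auto
qed

lemma periodic_of_int:
  fixes g :: "real \<Rightarrow> real"
  assumes p: "\<And>x. g (x + L) = g x"
  shows "g (x + of_int n * L) = g x"
proof (induction n rule: int_induct[where k = 0])
  case base
  then show ?case by simp
next
  case (step1 i)
  then show ?case using p[of "x + of_int i * L"] by (simp add: algebra_simps)
next
  case (step2 i)
  then show ?case using p[of "x + of_int (i - 1) * L"] by (simp add: algebra_simps)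
qed

lemma periodic_continuous_bounded:
  fixes g :: "real \<Rightarrow> real"
  assumes L: "0 < L" and p: "\<And>x. g (x + L) = g x" and c: "continuous_on UNIV g"
  shows "\<exists>M. \<forall>x. \<bar>g x\<bar> \<le> M"
proof -
  have "compact (g ` {0..L})"
    using c by (intro compact_continuous_image) (auto intro: continuous_on_subset)
  then obtain M where M: "\<And>x. x \<in> {0..L} \<Longrightarrow> \<bar>g x\<bar> \<le> M"
    by (metis bounded_real compact_imp_bounded imageI)
  have "\<bar>g x\<bar> \<le> M" for x
  proof -
    have "x rmod L \<in> {0..L}" using L rmod_nonneg[of L x] rmod_less[of L x] by auto
    moreover have "g (x rmod L) = g x"
      using periodic_of_int[of g L "x rmod L" "\<lfloor>x / L\<rfloor>", OF p] L by (simp add: rmod_def mult.commute)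
    ultimately show ?thesis using M by metis
  qed
  then show ?thesis by blast
qed

lemma derivative_chain_bounded:
  assumes L: "0 < L" and c: "derivative_chain n c" and p: "\<And>x. c 1 (x + L) = c 1 x"
    and cont: "continuous_on UNIV (c n)" and k: "1 \<le> k" "k \<le> n"
  shows "(\<forall>x. c k (x + L) = c k x)" "\<exists>M. \<forall>x. \<bar>c k x\<bar> \<le> M"
proof -
  have per: "\<forall>x. c k (x + L) = c k x"
    using k
  proof (induction k rule: nat_induct_at_least)
    case base
    then show ?case using p by simp
  next
    case (Suc k)
    then show ?case
      using c periodic_deriv[of "c k" "c (Suc k)" L] by (auto simp: derivative_chain_def)
  qed
  have "continuous_on UNIV (c k)"
  proof (cases "k = n")
    case False
    then show ?thesis
      using c k by (auto simp: derivative_chain_def intro!: DERIV_continuous_on[of _ _ "c (Suc k)"])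
  qed (use cont in simp)
  with per show "\<exists>M. \<forall>x. \<bar>c k x\<bar> \<le> M"
    using periodic_continuous_bounded[OF L] by blast
  show "\<forall>x. c k (x + L) = c k x" by (rule per)
qed

text \<open>The threefold Steklov mean of a three times continuously differentiable function has six continuous
derivatives, since the derivative of a mean is a difference quotient. It is close to the function
together with its first derivative; the second bound states this as a Lipschitz estimate.\<close>
lemma smooth_periodic_approximation:
  fixes L :: real
  assumes L: "0 < L" and \<eta>: "0 < \<eta>" and per: "\<And>x. f 0 (x + L) = f 0 x"
    and f: "derivative_chain 3 f" and cont: "continuous_on UNIV (f 3)"
  obtains c M where "derivative_chain 7 c" and "\<And>x. c 1 (x + L) = c 1 x"
    and "\<And>k x. k \<in> {5, 6, 7} \<Longrightarrow> \<bar>c k x\<bar> \<le> M"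
    and "\<And>x. \<bar>f 0 x - c 1 x\<bar> \<le> \<eta>"
    and "\<And>x y. \<bar>(f 0 x - c 1 x) - (f 0 y - c 1 y)\<bar> \<le> \<eta> * \<bar>x - y\<bar>"
proof -
  have df: "\<And>x. (f 0 has_real_derivative f 1 x) (at x)" "\<And>x. (f 1 has_real_derivative f 2 x) (at x)"
    "\<And>x. (f 2 has_real_derivative f 3 x) (at x)"
    using f by (auto simp: derivative_chain_def numeral_eq_Suc)
  have cf: "continuous_on UNIV (f 0)" "continuous_on UNIV (f 1)" "continuous_on UNIV (f 2)"
    using df by (meson DERIV_continuous_on)+
  have pf: "\<And>x. f 1 (x + L) = f 1 x" using periodic_deriv[OF df(1) per] by blast
  obtain M1 M2 where M12: "\<And>x. \<bar>f 1 x\<bar> \<le> M1" "\<And>x. \<bar>f 2 x\<bar> \<le> M2"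
    using periodic_continuous_bounded[OF L pf cf(2)]
      periodic_continuous_bounded[OF L periodic_deriv[OF df(2) pf] cf(3)] by blast
  define M0 where "M0 = max M1 M2"
  have M: "\<And>x. \<bar>f 1 x\<bar> \<le> M0" "\<And>x. \<bar>f 2 x\<bar> \<le> M0"
    using M12 by (auto simp: M0_def le_max_iff_disj)
  have M0: "0 \<le> M0" using M(1)[of 0] by linarith
  \<comment> \<open>Each of the three means contributes an error of at most \<open>\<delta> * M0\<close>.\<close>
  define \<delta> where "\<delta> = \<eta> / (3 * (M0 + 1))"
  have \<delta>: "0 < \<delta>" using \<eta> M0 by (simp add: \<delta>_def)
  have "3 * \<delta> * M0 = \<eta> * (M0 / (M0 + 1))"
    using M0 by (simp add: \<delta>_def field_simps)
  also have "\<dots> \<le> \<eta> * 1"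
    using \<eta> M0 by (intro mult_left_mono) auto
  finally have \<delta>\<eta>: "3 * \<delta> * M0 \<le> \<eta>" by simp
  define S where "S = steklov \<delta>"
  define D where "D = diff_quot \<delta>"
  have Sd: "\<And>g g' x. (\<And>x. (g has_real_derivative g' x) (at x)) \<Longrightarrow> (S g has_real_derivative S g' x) (at x)"
    using steklov_deriv \<delta> by (simp add: S_def)
  have Dd: "\<And>g g' x. (\<And>x. (g has_real_derivative g' x) (at x)) \<Longrightarrow> (D g has_real_derivative D g' x) (at x)"
    using diff_quot_deriv by (simp add: D_def)
  have SD: "\<And>g x. continuous_on UNIV g \<Longrightarrow> (S g has_real_derivative D g x) (at x)"
    using steklov_deriv_diff_quot \<delta> by (simp add: S_def D_def)
  have cS: "\<And>g. continuous_on UNIV g \<Longrightarrow> continuous_on UNIV (S g)"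
    using continuous_on_steklov \<delta> by (simp add: S_def)
  have cD: "\<And>g. continuous_on UNIV g \<Longrightarrow> continuous_on UNIV (D g)"
    using continuous_on_diff_quot by (simp add: D_def)
  obtain U where U: "\<And>x. (U has_real_derivative S (S (S (f 0))) x) (at x)"
    using continuous_antiderivative[OF cS[OF cS[OF cS[OF cf(1)]]]] by blast
  define c where "c k = [U, S (S (S (f 0))), S (S (S (f 1))), S (S (S (f 2))), S (S (S (f 3))),
    D (S (S (f 3))), D (D (S (f 3))), D (D (D (f 3)))] ! k" for k
  have c1: "c 1 = S (S (S (f 0)))" by (simp add: c_def)
  have chain: "derivative_chain 7 c"
    unfolding derivative_chain_def
  proof (intro allI impI)
    fix k x assume "k < (7::nat)"
    then consider "k = 0" | "k = 1" | "k = 2" | "k = 3" | "k = 4" | "k = 5" | "k = 6" by linarith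
    then show "(c k has_real_derivative c (Suc k) x) (at x)"
      by cases (simp_all add: c_def U Sd df[unfolded One_nat_def] SD Dd cS cont)
  qed
  have perc: "\<And>x. c 1 (x + L) = c 1 x"
    unfolding c1 S_def by (intro periodic_steklov per)
  have c7: "continuous_on UNIV (c 7)" by (simp add: c_def cD cont)
  have "\<exists>M. \<forall>x. \<bar>c k x\<bar> \<le> M" if "k \<in> {5, 6, 7}" for k
    using derivative_chain_bounded(2)[OF L chain perc c7, of k] that by auto
  then obtain B where B: "\<And>k x. k \<in> {5, 6, 7} \<Longrightarrow> \<bar>c k x\<bar> \<le> B k" by metis
  have bnd: "\<bar>c k x\<bar> \<le> max (B 5) (max (B 6) (B 7))" if "k \<in> {5, 6, 7}" for k x
    using B[OF that, of x] that by auto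
  have near: "\<bar>S (S (S (f 0))) x - f 0 x\<bar> \<le> \<eta>" "\<bar>S (S (S (f 1))) x - f 1 x\<bar> \<le> \<eta>" for x
    using abs_steklov3_minus_le[OF df(1) cf(2) \<delta> M(1), of x]
      abs_steklov3_minus_le[OF df(2) cf(3) \<delta> M(2), of x] \<delta>\<eta> by (auto simp: S_def)
  have "\<bar>f 0 x - c 1 x\<bar> \<le> \<eta>" for x
    unfolding c1 using near(1)[of x] by (simp add: abs_minus_commute)
  moreover have "\<bar>(f 0 x - c 1 x) - (f 0 y - c 1 y)\<bar> \<le> \<eta> * \<bar>x - y\<bar>" for x y
  proof -
    have "((\<lambda>x. f 0 x - c 1 x) has_real_derivative f 1 z - S (S (S (f 1))) z) (at z)" for z
      unfolding c1 by (intro DERIV_diff Sd df)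
    then show ?thesis
      using field_differentiable_bound[of UNIV "\<lambda>x. f 0 x - c 1 x"
          "\<lambda>z. f 1 z - S (S (S (f 1))) z" \<eta> x y] near(2)
      by (auto simp: abs_minus_commute)
  qed
  ultimately show ?thesis using that[OF chain perc bnd] by blast
qed

section \<open>Stability in the maximum norm\<close>

text \<open>The first differences of a solution solve the same scheme with differenced data and forcing. Hence data and
forcing of size \<open>O(1)\<close> with differences of size \<open>O(h)\<close> give a solution that is bounded uniformly in the mesh
size.\<close>
lemma hv_sup_stability:
  fixes a b f g :: "int \<Rightarrow> real \<Rightarrow> real"
  assumes N: "0 < N" and T: "0 \<le> T" and kap: "0 \<le> \<kappa>" and h: "0 \<le> h" "real N * h = L"
    and per: "\<And>j t. t \<in> {0..T} \<Longrightarrow> a (j + int N) t = a j t"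
             "\<And>j t. t \<in> {0..T} \<Longrightarrow> b (j + int N) t = b j t"
    and da: "\<And>j t. t \<in> {0..T} \<Longrightarrow> (a j has_real_derivative
        - (\<kappa> * (a (j - 1) t - 7/2 * b (j - 1) t + 2 * a j t + 1/2 * b j t)) + f j t)
        (at t within {0..T})"
    and db: "\<And>j t. t \<in> {0..T} \<Longrightarrow> (b j has_real_derivative
        - (\<kappa> * (a (j + 1) t - a j t)) + g j t) (at t within {0..T})"
    and f: "\<And>j t. t \<in> {0..T} \<Longrightarrow> \<bar>f j t\<bar> \<le> K"
           "\<And>j t. t \<in> {0..T} \<Longrightarrow> \<bar>f (j + 1) t - f j t\<bar> \<le> h * K"
    and g: "\<And>j t. t \<in> {0..T} \<Longrightarrow> \<bar>g j t\<bar> \<le> K"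
           "\<And>j t. t \<in> {0..T} \<Longrightarrow> \<bar>g (j + 1) t - g j t\<bar> \<le> h * K"
    and a0: "\<And>j. \<bar>a j 0\<bar> \<le> M" "\<And>j. \<bar>a (j + 1) 0 - a j 0\<bar> \<le> h * M"
    and b0: "\<And>j. \<bar>b j 0\<bar> \<le> M" "\<And>j. \<bar>b (j + 1) 0 - b j 0\<bar> \<le> h * M"
    and i: "i \<in> {0..<int N}"
  defines "R \<equiv> sqrt (31 * exp T) * (1 + L) * (M + sqrt T * K)"
  shows "\<bar>a i T\<bar> \<le> R \<and> \<bar>b i T\<bar> \<le> R"
proof -
  have M: "0 \<le> M" using a0(1)[of 0] by linarith
  have K: "0 \<le> K" using f(1)[of 0 0] T by (force intro: order_trans[OF abs_ge_zero])
  define P where "P = sqrt (31 * exp T) * (M + sqrt T * K)"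
  have P: "0 \<le> P" using M K T by (simp add: P_def)
  have le: "exp T * 31 * real N * ((r * M)\<^sup>2 + T * (r * K)\<^sup>2) \<le> real N * (r * P)\<^sup>2"
    if "0 \<le> r" for r
  proof -
    have "M\<^sup>2 + T * K\<^sup>2 \<le> (M + sqrt T * K)\<^sup>2"
      using M K T by (simp add: power2_sum power_mult_distrib)
    then have "(31 * exp T * real N * r\<^sup>2) * (M\<^sup>2 + T * K\<^sup>2)
        \<le> (31 * exp T * real N * r\<^sup>2) * (M + sqrt T * K)\<^sup>2"
      by (intro mult_left_mono) auto
    also have "\<dots> = real N * (r * P)\<^sup>2"
      by (simp add: P_def power_mult_distrib)
    also have "(31 * exp T * real N * r\<^sup>2) * (M\<^sup>2 + T * K\<^sup>2)
        = exp T * 31 * real N * ((r * M)\<^sup>2 + T * (r * K)\<^sup>2)"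
      by (simp add: power_mult_distrib algebra_simps)
    finally show ?thesis .
  qed
  have s0: "(\<Sum>j\<in>{0..<int N}. hv_energy (a j T) (b (j - 1) T) (b j T)) \<le> real N * P\<^sup>2"
    using hv_stability[OF T kap per da db f(1) g(1) a0(1) b0(1)] le[of 1] by simp
  define a1 where "a1 j t = a (j + 1) t - a j t" for j t
  define b1 where "b1 j t = b (j + 1) t - b j t" for j t
  define f1 where "f1 j t = f (j + 1) t - f j t" for j t
  define g1 where "g1 j t = g (j + 1) t - g j t" for j t
  have "(\<Sum>j\<in>{0..<int N}. hv_energy (a1 j T) (b1 (j - 1) T) (b1 j T))
       \<le> exp T * 31 * real N * ((h * M)\<^sup>2 + T * (h * K)\<^sup>2)"
  proof (rule hv_stability[OF T kap, where f = f1 and g = g1])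
    fix j t assume t: "t \<in> {0..T}"
    show "a1 (j + int N) t = a1 j t" "b1 (j + int N) t = b1 j t"
      using per[OF t, of "j + 1"] per[OF t, of j] by (simp_all add: a1_def b1_def add_ac)
    show "(a1 j has_real_derivative - (\<kappa> * (a1 (j - 1) t - 7/2 * b1 (j - 1) t + 2 * a1 j t
        + 1/2 * b1 j t)) + f1 j t) (at t within {0..T})"
      using DERIV_diff[OF da[OF t, of "j + 1"] da[OF t, of j]]
      unfolding a1_def b1_def f1_def by (simp add: algebra_simps)
    show "(b1 j has_real_derivative - (\<kappa> * (a1 (j + 1) t - a1 j t)) + g1 j t) (at t within {0..T})"
      using DERIV_diff[OF db[OF t, of "j + 1"] db[OF t, of j]]
      unfolding a1_def b1_def g1_def by (simp add: algebra_simps)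
    show "\<bar>f1 j t\<bar> \<le> h * K" "\<bar>g1 j t\<bar> \<le> h * K"
      using f(2)[OF t] g(2)[OF t] by (simp_all add: f1_def g1_def)
  next
    fix j show "\<bar>a1 j 0\<bar> \<le> h * M" "\<bar>b1 j 0\<bar> \<le> h * M"
      using a0(2) b0(2) by (simp_all add: a1_def b1_def)
  qed
  also note le[OF h(1)]
  finally have s1: "(\<Sum>j\<in>{0..<int N}. hv_energy (a1 j T) (b1 (j - 1) T) (b1 j T))
       \<le> real N * (h * P)\<^sup>2" .
  have R: "R = P + real N * (h * P)"
    unfolding R_def P_def h(2)[symmetric] by (simp add: algebra_simps)
  have hP: "0 \<le> h * P" using h(1) P by simp
  have "\<bar>a i T\<bar> \<le> R" unfolding R
  proof (rule discrete_sobolev[OF N P hP _ _ i, of "\<lambda>j. a j T"])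
    show "(\<Sum>j\<in>{0..<int N}. (a j T)\<^sup>2) \<le> real N * P\<^sup>2"
      by (rule order_trans[OF sum_mono s0]) (rule power2_le_hv_energy)
    show "(\<Sum>j\<in>{0..<int N}. (a (j + 1) T - a j T)\<^sup>2) \<le> real N * (h * P)\<^sup>2"
      by (rule order_trans[OF sum_mono s1[unfolded a1_def]]) (rule power2_le_hv_energy)
  qed
  moreover have "\<bar>b i T\<bar> \<le> R" unfolding R
  proof (rule discrete_sobolev[OF N P hP _ _ i, of "\<lambda>j. b j T"])
    show "(\<Sum>j\<in>{0..<int N}. (b j T)\<^sup>2) \<le> real N * P\<^sup>2"
      by (rule order_trans[OF sum_mono s0]) (rule power2_le_hv_energy)
    show "(\<Sum>j\<in>{0..<int N}. (b (j + 1) T - b j T)\<^sup>2) \<le> real N * (h * P)\<^sup>2"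
      by (rule order_trans[OF sum_mono s1[unfolded b1_def]]) (rule power2_le_hv_energy)
  qed
  ultimately show ?thesis by blast
qed

section \<open>Consistency of the corrected interpolant\<close>

lemma taylor_remainder_le:
  assumes "derivative_chain n c" and "\<And>x. \<bar>c n x\<bar> \<le> M"
  shows "\<bar>c 0 (x + s) - (\<Sum>m<n. c m x / fact m * s ^ m)\<bar> \<le> M / fact n * \<bar>s\<bar> ^ n"
proof -
  have "((\<lambda>t. c m (x + t)) has_real_derivative c (Suc m) (x + t)) (at t)" if "m < n" for m t
    using DERIV_shift[of "c m" "c (Suc m) (t + x)" t x] assms(1) that
    by (simp add: derivative_chain_def add.commute)
  then have "\<exists>t. \<bar>t\<bar> \<le> \<bar>s\<bar> \<and> c 0 (x + s)
      = (\<Sum>m<n. c m (x + 0) / fact m * s ^ m) + c n (x + t) / fact n * s ^ n"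
    by (intro Maclaurin_bi_le[of "\<lambda>m t. c m (x + t)"]) auto
  then obtain t where "c 0 (x + s) - (\<Sum>m<n. c m x / fact m * s ^ m) = c n (x + t) / fact n * s ^ n"
    by (metis add_0_right add_diff_cancel_left')
  then show ?thesis
    using assms(2)[of "x + t"] by (simp add: abs_mult power_abs divide_right_mono mult_right_mono)
qed

text \<open>The residual of the nodal equation, divided by the velocity, on the profile \<open>c 1\<close> moved
along characteristics, with \<open>y\<close> the foot point of the node. The nodal values are sampled from the corrected
profile \<open>c 1 - h^4/180 * c 5\<close>, the cell values are the exact means of \<open>c 1\<close>. On the uncorrected profile the
nodal residual is \<open>h^3/60 * c 5\<close> to leading order; the nodal values enter the nodal equation with total weight
\<open>(1 + 2)/h\<close>, and \<open>3 * h^3/180 = h^3/60\<close>, so the correction cancels it.\<close>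
definition hv_node_residual :: "real \<Rightarrow> (nat \<Rightarrow> real \<Rightarrow> real) \<Rightarrow> real \<Rightarrow> real" where
  "hv_node_residual h c y =
     1 / h * ((c 1 (y - h) - h ^ 4 / 180 * c 5 (y - h)) - 7/2 * ((c 0 y - c 0 (y - h)) / h)
       + 2 * (c 1 y - h ^ 4 / 180 * c 5 y) + 1/2 * ((c 0 (y + h) - c 0 y) / h))
     - (c 2 y - h ^ 4 / 180 * c 6 y)"

text \<open>The residual of the cell equation on the same data, again divided by the velocity. It is due to the
correction alone.\<close>
definition hv_cell_residual :: "real \<Rightarrow> (nat \<Rightarrow> real \<Rightarrow> real) \<Rightarrow> real \<Rightarrow> real" where
  "hv_cell_residual h c y =
     1 / h * ((c 1 (y + h) - h ^ 4 / 180 * c 5 (y + h)) - (c 1 y - h ^ 4 / 180 * c 5 y))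
     - (c 1 (y + h) - c 1 y) / h"

lemma abs_diff_le_chain:
  assumes "derivative_chain n c" "k < n" and "\<And>x. \<bar>c (Suc k) x\<bar> \<le> M"
  shows "\<bar>c k x - c k y\<bar> \<le> M * \<bar>x - y\<bar>"
  using field_differentiable_bound[of UNIV "c k" "c (Suc k)" M x y] assms
  by (auto simp: derivative_chain_def)

lemma hv_cell_residual_le:
  assumes c: "derivative_chain 6 c" and M: "\<And>x. \<bar>c 6 x\<bar> \<le> M" and h: "0 < h"
  shows "\<bar>hv_cell_residual h c y\<bar> \<le> M * h ^ 4"
proof -
  have M0: "0 \<le> M" using M[of 0] by linarith
  have "hv_cell_residual h c y = - (h ^ 3 / 180) * (c 5 (y + h) - c 5 y)"
    using h by (simp add: hv_cell_residual_def field_simps power_numeral_reduce)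
  then have "\<bar>hv_cell_residual h c y\<bar> = h ^ 3 / 180 * \<bar>c 5 (y + h) - c 5 y\<bar>"
    using h by (simp add: abs_mult)
  also have "\<dots> \<le> h ^ 3 / 180 * (M * \<bar>y + h - y\<bar>)"
    using abs_diff_le_chain[OF c, of 5 M "y + h" y] M h by (intro mult_left_mono) auto
  also have "\<dots> = M * h ^ 4 / 180" using h by (simp add: power_numeral_reduce)
  also have "\<dots> \<le> M * h ^ 4" using M0 h by simp
  finally show ?thesis .
qed

text \<open>The Taylor expansions about \<open>y\<close> leave no power of \<open>h\<close> below the fourth: the scheme differentiates cubic
polynomials exactly, and the correction removes the term with \<open>h^3\<close>.\<close>
lemma hv_node_residual_le:
  assumes c: "derivative_chain 6 c" and M: "\<And>x. \<bar>c 6 x\<bar> \<le> M" and h: "0 < h"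
  shows "\<bar>hv_node_residual h c y\<bar> \<le> M * h ^ 4"
proof -
  have M0: "0 \<le> M" using M[of 0] by linarith
  have "derivative_chain 5 (\<lambda>k. c (Suc k))" using c by (auto simp: derivative_chain_def)
  note t1 = taylor_remainder_le[OF this, of M y "- h"]
  define r1 where "r1 = c 1 (y - h) - (c 1 y - h * c 2 y + h^2 / 2 * c 3 y - h^3 / 6 * c 4 y + h^4 / 24 * c 5 y)"
  define rp where "rp = c 0 (y + h) - (c 0 y + h * c 1 y + h^2 / 2 * c 2 y + h^3 / 6 * c 3 y + h^4 / 24 * c 4 y + h^5 / 120 * c 5 y)"
  define rm where "rm = c 0 (y - h) - (c 0 y - h * c 1 y + h^2 / 2 * c 2 y - h^3 / 6 * c 3 y + h^4 / 24 * c 4 y - h^5 / 120 * c 5 y)"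
  have r1: "\<bar>r1\<bar> \<le> M / 120 * h ^ 5"
    using t1 M h by (simp add: r1_def lessThan_Suc eval_nat_numeral algebra_simps)
  have rp: "\<bar>rp\<bar> \<le> M / 720 * h ^ 6"
    using taylor_remainder_le[OF c M, of y h] h
    by (simp add: rp_def lessThan_Suc eval_nat_numeral algebra_simps)
  have rm: "\<bar>rm\<bar> \<le> M / 720 * h ^ 6"
    using taylor_remainder_le[OF c M, of y "-h"] h
    by (simp add: rm_def lessThan_Suc eval_nat_numeral algebra_simps)
  have d5: "\<bar>c 5 (y - h) - c 5 y\<bar> \<le> M * h"
    using abs_diff_le_chain[OF c, of 5 M "y - h" y] M h by simp
  have "hv_node_residual h c y = r1 / h + 7/2 * (rm / h\<^sup>2) + 1/2 * (rp / h\<^sup>2)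
      - h ^ 3 / 180 * (c 5 (y - h) - c 5 y) + h ^ 4 / 180 * c 6 y"
    using h unfolding hv_node_residual_def r1_def rp_def rm_def
    by (simp add: field_simps power_numeral_reduce)
  moreover have "\<bar>r1 / h\<bar> \<le> M / 120 * h ^ 4"
    using r1 h by (simp add: abs_divide field_simps power_numeral_reduce)
  moreover have "\<bar>rp / h\<^sup>2\<bar> \<le> M / 720 * h ^ 4"
    using rp h by (simp add: abs_divide field_simps power_numeral_reduce)
  moreover have "\<bar>rm / h\<^sup>2\<bar> \<le> M / 720 * h ^ 4"
    using rm h by (simp add: abs_divide field_simps power_numeral_reduce)
  moreover have "\<bar>h ^ 3 / 180 * (c 5 (y - h) - c 5 y)\<bar> \<le> M / 180 * h ^ 4"
    using mult_left_mono[OF d5, of "h ^ 3 / 180"] h by (simp add: abs_mult power_numeral_reduce mult_ac)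
  moreover have "\<bar>h ^ 4 / 180 * c 6 y\<bar> \<le> M / 180 * h ^ 4"
    using mult_left_mono[OF M[of y], of "h ^ 4 / 180"] h by (simp add: abs_mult mult_ac)
  moreover have "0 \<le> M * h ^ 4" using M0 by simp
  ultimately show ?thesis by linarith
qed

section \<open>The exact solution\<close>

lemma advection_constant_along_characteristic:
  assumes L: "0 < L" and T: "0 < T" and lam: "0 \<le> lam"
    and w: "advection_solution L T lam w0 w"
    and x: "x \<le> L" and t: "t \<le> T" and s: "0 \<le> s" "s \<le> t" and xs: "0 \<le> x - lam * (t - s)"
  shows "w x t = w (x - lam * (t - s)) s"
proof -
  let ?W = "\<lambda>(x, t). w x t" and ?R = "{0..L} \<times> {0..T}"
  define \<gamma> where "\<gamma> r = (x - lam * (t - r), r)" for r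
  have "((\<lambda>r. ?W (\<gamma> r)) has_derivative (\<lambda>_. 0)) (at r within {s..t})" if r: "r \<in> {s..t}" for r
  proof -
    have "lam * (t - r) \<le> lam * (t - s)" "0 \<le> lam * (t - r)"
      using lam r by (auto intro: mult_left_mono)
    then have mem: "x - lam * (t - r) \<in> {0..L}" "r \<in> {0..T}"
      using x xs s t r by auto
    have sub: "\<gamma> ` {s..t} \<subseteq> ?R"
    proof
      fix p assume "p \<in> \<gamma> ` {s..t}"
      then obtain q where q: "q \<in> {s..t}" "p = \<gamma> q" by blast
      have "lam * (t - q) \<le> lam * (t - s)" "0 \<le> lam * (t - q)"
        using lam q by (auto intro: mult_left_mono)
      then show "p \<in> ?R" using q x xs s t by (auto simp: \<gamma>_def)
    qed
    define y where "y = x - lam * (t - r)"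
    have yr: "\<gamma> r = (y, r)" "(y, r) \<in> ?R" using mem by (auto simp: y_def \<gamma>_def)
    obtain D where D: "(?W has_derivative D) (at (y, r) within ?R)"
      using w yr(2) unfolding advection_solution_def differentiable_on_def differentiable_def by blast
    interpret D: bounded_linear D using D by (rule has_derivative_bounded_linear)
    obtain wt wx where wt: "((\<lambda>s. w y s) has_real_derivative wt) (at r within {0..T})"
      and wx: "((\<lambda>z. w z r) has_real_derivative wx) (at y within {0..L})"
      and pde: "wt + lam * wx = 0"
      using w mem unfolding advection_solution_def y_def by blast
    \<comment> \<open>The one-sided partial derivatives are unique, so they are the two components of \<open>D\<close>.\<close>
    have "((\<lambda>s. ?W (y, s)) has_derivative (\<lambda>h. D (0, h))) (at r within {0..T})"
      using mem yr(2)
      by (intro has_derivative_in_compose[of "\<lambda>s. (y, s)" "\<lambda>h. (0, h)", OF _ has_derivative_subset[OF D]])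
        (auto intro!: derivative_eq_intros)
    then have "D (0, 1) = wt"
      using frechet_derivative_unique_within_closed_interval[of 0 T r "\<lambda>s. w y s" "\<lambda>h. D (0, h)" "(*) wt"]
        wt mem T by (auto simp: has_field_derivative_def fun_eq_iff)
    have "((\<lambda>z. ?W (z, r)) has_derivative (\<lambda>h. D (h, 0))) (at y within {0..L})"
      using mem yr(2)
      by (intro has_derivative_in_compose[of "\<lambda>z. (z, r)" "\<lambda>h. (h, 0)", OF _ has_derivative_subset[OF D]])
        (auto intro!: derivative_eq_intros)
    then have "D (1, 0) = wx"
      using frechet_derivative_unique_within_closed_interval[of 0 L y "\<lambda>z. w z r" "\<lambda>h. D (h, 0)" "(*) wx"]
        wx yr(2) L by (auto simp: has_field_derivative_def fun_eq_iff)
    have d\<gamma>: "(\<gamma> has_derivative (\<lambda>h. (lam * h, h))) (at r within {s..t})"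
      unfolding \<gamma>_def by (auto intro!: derivative_eq_intros)
    have "(?W has_derivative D) (at (\<gamma> r) within \<gamma> ` {s..t})"
      unfolding yr(1) by (rule has_derivative_subset[OF D sub])
    from has_derivative_in_compose[OF d\<gamma> this]
    have "((\<lambda>r. ?W (\<gamma> r)) has_derivative (\<lambda>h. D (lam * h, h))) (at r within {s..t})" .
    moreover have "D (lam * h, h) = 0" for h
    proof -
      have "(lam * h, h) = (lam * h) *\<^sub>R (1, 0) + h *\<^sub>R (0::real, 1::real)" by simp
      then have "D (lam * h, h) = (lam * h) *\<^sub>R D (1, 0) + h *\<^sub>R D (0, 1)"
        by (metis D.add D.scaleR)
      also have "\<dots> = h * (wt + lam * wx)"
        by (simp add: \<open>D (1, 0) = wx\<close> \<open>D (0, 1) = wt\<close> algebra_simps)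
      finally show ?thesis by (simp add: pde)
    qed
    ultimately show ?thesis by simp
  qed
  then have "\<exists>c. \<forall>r\<in>{s..t}. ?W (\<gamma> r) = c"
    using has_derivative_zero_constant[of "{s..t}" "\<lambda>r. ?W (\<gamma> r)"] by auto
  then have "?W (\<gamma> t) = ?W (\<gamma> s)" using s by force
  then show ?thesis by (simp add: \<gamma>_def)
qed

lemma periodic_ext_add: "0 < L \<Longrightarrow> periodic_ext L f (x + L) = periodic_ext L f x"
  unfolding periodic_ext_def by (simp add: rmod_def add_divide_distrib algebra_simps)

lemma periodic_ext_eq:
  assumes "0 < L" "f 0 = f L" "x \<in> {0..L}"
  shows "periodic_ext L f x = f x"
proof (cases "x = L")
  case True
  then show ?thesis using assms periodic_ext_add[of L f 0] by (simp add: periodic_ext_def)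
next
  case False
  then have "x rmod L = x" using assms by (intro rmod_unique[of _ _ _ 0]) auto
  then show ?thesis by (simp add: periodic_ext_def)
qed

text \<open>A characteristic is followed backwards; whenever it leaves through \<open>x = 0\<close> it is continued from \<open>x = L\<close> by
the boundary condition, so the induction runs over the number of turns.\<close>
lemma advection_solution_eq:
  assumes L: "0 < L" and T: "0 < T" and lam: "0 < lam"
    and w: "advection_solution L T lam w0 w" and "x \<in> {0..L}" "t \<in> {0..T}"
  shows "w x t = periodic_ext L w0 (x - lam * t)"
proof -
  have bc: "\<And>t. t \<in> {0..T} \<Longrightarrow> w 0 t = w L t" and ic: "\<And>x. x \<in> {0..L} \<Longrightarrow> w x 0 = w0 x"
    using w unfolding advection_solution_def by blast+
  have w0: "w0 0 = w0 L"
    using bc[of 0] ic[of 0] ic[of L] L T by simp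
  have "lam * t \<le> x + real n * L \<Longrightarrow> ?thesis" for n
    using assms(5,6)
  proof (induction n arbitrary: x t)
    case 0
    then have "w x t = w (x - lam * t) 0"
      using advection_constant_along_characteristic[OF L T _ w, of x t 0] lam by auto
    moreover have "x - lam * t \<in> {0..L}" using 0 lam by (auto intro: order_trans[of _ x])
    ultimately show ?case
      using ic periodic_ext_eq[of L w0, OF L w0] by simp
  next
    case (Suc n)
    show ?case
    proof (cases "lam * t \<le> x")
      case True
      then have "lam * t \<le> x + real n * L" using L by (simp add: add_increasing2)
      then show ?thesis using Suc.IH Suc.prems by blast
    next
      case False
      \<comment> \<open>the time at which the characteristic passes through the boundary\<close>
      define s where "s = t - x / lam"
      have s: "0 \<le> s" "s \<le> t" "lam * (t - s) = x" "lam * s = lam * t - x"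
        using False lam Suc.prems by (auto simp: s_def field_simps)
      have "w x t = w 0 s"
        using advection_constant_along_characteristic[OF L T _ w, of x t s] s lam Suc.prems by auto
      also have "\<dots> = w L s"
        using bc[of s] s(1,2) Suc.prems by simp
      also have "\<dots> = periodic_ext L w0 (L - lam * s)"
        using s Suc.prems L by (intro Suc.IH) (auto simp: algebra_simps)
      also have "L - lam * s = (x - lam * t) + L" using s by simp
      finally show ?thesis using periodic_ext_add[OF L] by simp
    qed
  qed
  moreover obtain n where "lam * t / L \<le> real n" using real_arch_simple by blast
  then have "lam * t \<le> x + real n * L" using L assms(5) by (simp add: field_simps add_increasing)
  ultimately show ?thesis by blast
qed

section \<open>The error relative to a smooth profile\<close>

lemma node_add_one: "node L N (j + 1) = node L N j + mesh L N"
  by (simp add: node_def algebra_simps)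

lemma node_add_period: "0 < N \<Longrightarrow> node L N (j + int N) = node L N j + L"
  by (simp add: node_def mesh_def field_simps)

text \<open>The scheme is compared with the smooth profile \<open>c 1\<close> moved along characteristics, while its initial data may
differ from that profile by a grid function of size \<open>\<eta>\<close> with differences of size \<open>h * \<eta>\<close>.\<close>
lemma hv_error_bound:
  fixes c :: "nat \<Rightarrow> real \<Rightarrow> real" and v vbar :: "int \<Rightarrow> real \<Rightarrow> real"
  assumes L: "0 < L" and T: "0 < T" and lam: "0 < lam" and N: "0 < N"
    and c: "derivative_chain 7 c" and per: "\<And>x. c 1 (x + L) = c 1 x"
    and M: "\<And>k x. k \<in> {5, 6, 7} \<Longrightarrow> \<bar>c k x\<bar> \<le> M"
    and hv: "hybrid_variable_solution L T lam N v vbar"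
  defines "h \<equiv> mesh L N"
  assumes v0: "\<And>j. \<bar>v j 0 - c 1 (node L N j)\<bar> \<le> \<eta>"
      "\<And>j. \<bar>(v (j + 1) 0 - c 1 (node L N (j + 1))) - (v j 0 - c 1 (node L N j))\<bar> \<le> h * \<eta>"
    and vbar0: "\<And>j. \<bar>vbar j 0 - diff_quot h (c 0) (node L N j)\<bar> \<le> \<eta>"
      "\<And>j. \<bar>(vbar (j + 1) 0 - diff_quot h (c 0) (node L N (j + 1)))
           - (vbar j 0 - diff_quot h (c 0) (node L N j))\<bar> \<le> h * \<eta>"
    and i: "i \<in> {0..<int N}"
  defines "R \<equiv> sqrt (31 * exp T) * (1 + L) * ((\<eta> + M * h ^ 4) + sqrt T * (lam * (M * h ^ 4)))"
  shows "\<bar>v i T - c 1 (node L N i - lam * T)\<bar> \<le> R + M * h ^ 4"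
    and "\<bar>vbar i T - diff_quot h (c 0) (node L N i - lam * T)\<bar> \<le> R"
proof -
  have h: "0 < h" "real N * h = L" using L N by (simp_all add: h_def mesh_def)
  have M0: "0 \<le> M" using M[of 5 0] by (auto intro: order_trans[OF abs_ge_zero])
  have dc: "\<And>k x. k < 7 \<Longrightarrow> (c k has_real_derivative c (Suc k) x) (at x)"
    using c by (simp add: derivative_chain_def)
  have dc': "\<And>x. (c 0 has_real_derivative c 1 x) (at x)" "\<And>x. (c 1 has_real_derivative c 2 x) (at x)"
      "\<And>x. (c 5 has_real_derivative c 6 x) (at x)"
    using dc[of 0] dc[of 1] dc[of 5] by (simp_all add: numeral_eq_Suc)
  define y where "y j t = node L N j - lam * t" for j t
  have y1: "y (j + 1) t = y j t + h" "y (j - 1) t = y j t - h" for j t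
    using node_add_one[of L N j] node_add_one[of L N "j - 1"] by (simp_all add: y_def h_def)
  have yN: "y (j + int N) t = y j t + L" for j t
    using node_add_period[OF N] by (simp add: y_def)
  have y0: "y j 0 = node L N j" for j by (simp add: y_def)
  have dy: "(y j has_real_derivative - lam) (at t within S)" for j t S
    unfolding y_def[abs_def] by (auto intro!: derivative_eq_intros)
  \<comment> \<open>The errors \<open>a\<close>, \<open>b\<close> solve the scheme with the forcing \<open>f\<close>, \<open>g\<close>.\<close>
  define a where "a j t = v j t - (c 1 (y j t) - h ^ 4 / 180 * c 5 (y j t))" for j t
  define b where "b j t = vbar j t - diff_quot h (c 0) (y j t)" for j t
  define f where "f j t = - lam * hv_node_residual h c (y j t)" for j t
  define g where "g j t = - lam * hv_cell_residual h c (y j t)" for j t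
  define K where "K = lam * (M * h ^ 4)"
  have c6: "derivative_chain 6 c" using c by (simp add: derivative_chain_def)
  \<comment> \<open>The residuals are linear in the profile, so their differences are residuals of a differenced profile.\<close>
  define d where "d k x = c k (x + h) - c k x" for k x
  have d6: "derivative_chain 6 d"
    unfolding derivative_chain_def d_def
    using dc by (auto intro!: DERIV_diff iffD1[OF DERIV_shift])
  have dM: "\<bar>d 6 x\<bar> \<le> M * h" for x
    using abs_diff_le_chain[OF c, of 6 M "x + h" x] M h by (simp add: d_def)
  have per5: "c 5 (x + L) = c 5 x" for x
    using derivative_chain_bounded(1)[OF L c6 per DERIV_continuous_on, of "c 7" 5] dc[of 6]
    by simp
  have perq: "diff_quot h (c 0) (x + L) = diff_quot h (c 0) x" for x
  proof -
    have "((\<lambda>x. c 0 (x + L) - c 0 x) has_real_derivative 0) (at x)" for x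
      using DERIV_diff[OF iffD1[OF DERIV_shift dc'(1)[of "x + L"]] dc'(1)[of x]] per by simp
    then have "c 0 ((x + h) + L) - c 0 (x + h) = c 0 (x + L) - c 0 x"
      using DERIV_isconst_all[of "\<lambda>x. c 0 (x + L) - c 0 x"] by blast
    then show ?thesis by (simp add: diff_quot_def algebra_simps)
  qed
  have main: "\<bar>a i T\<bar> \<le> R \<and> \<bar>b i T\<bar> \<le> R"
    unfolding R_def K_def[symmetric]
  proof (rule hv_sup_stability[where f = f and g = g and \<kappa> = "lam / h" and a = a and b = b])
    show "0 < N" "0 \<le> T" "0 \<le> lam / h" "0 \<le> h" "real N * h = L" "i \<in> {0..<int N}"
      using N T lam h i by auto
  next
    fix j t assume t: "t \<in> {0..T}"
    show "a (j + int N) t = a j t" "b (j + int N) t = b j t"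
      using hv t unfolding hybrid_variable_solution_def
      by (simp_all add: a_def b_def yN per[unfolded One_nat_def] per5 perq)
    have dv: "(v j has_real_derivative - (lam / h * (v (j - 1) t - 7 / 2 * vbar (j - 1) t
          + 2 * v j t + 1 / 2 * vbar j t))) (at t within {0..T})"
      and dvbar: "(vbar j has_real_derivative - (lam / h * (v (j + 1) t - v j t))) (at t within {0..T})"
      using hv t unfolding hybrid_variable_solution_def h_def by blast+
    have "(a j has_real_derivative - (lam / h * (v (j - 1) t - 7 / 2 * vbar (j - 1) t
          + 2 * v j t + 1 / 2 * vbar j t))
          - (c 2 (y j t) * - lam - h ^ 4 / 180 * (c 6 (y j t) * - lam))) (at t within {0..T})"
      unfolding a_def
      by (intro DERIV_diff DERIV_cmult dv DERIV_chain2[OF dc'(2) dy] DERIV_chain2[OF dc'(3) dy])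
    moreover have "- (lam / h * (v (j - 1) t - 7 / 2 * vbar (j - 1) t
          + 2 * v j t + 1 / 2 * vbar j t))
          - (c 2 (y j t) * - lam - h ^ 4 / 180 * (c 6 (y j t) * - lam))
        = - (lam / h * (a (j - 1) t - 7/2 * b (j - 1) t + 2 * a j t + 1/2 * b j t)) + f j t"
      using h(1) unfolding a_def b_def f_def hv_node_residual_def diff_quot_def y1
      by (simp add: field_simps)
    ultimately show "(a j has_real_derivative - (lam / h * (a (j - 1) t - 7/2 * b (j - 1) t
        + 2 * a j t + 1/2 * b j t)) + f j t) (at t within {0..T})" by simp
    have "(b j has_real_derivative - (lam / h * (v (j + 1) t - v j t))
          - (diff_quot h (c 1) (y j t) * - lam)) (at t within {0..T})"
      unfolding b_def
      by (intro DERIV_diff dvbar DERIV_chain2[OF diff_quot_deriv[OF dc'(1)] dy])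
    moreover have "- (lam / h * (v (j + 1) t - v j t)) - (diff_quot h (c 1) (y j t) * - lam)
        = - (lam / h * (a (j + 1) t - a j t)) + g j t"
      using h(1) unfolding a_def g_def hv_cell_residual_def diff_quot_def y1
      by (simp add: field_simps)
    ultimately show "(b j has_real_derivative - (lam / h * (a (j + 1) t - a j t)) + g j t)
        (at t within {0..T})" by simp
    show "\<bar>f j t\<bar> \<le> K" "\<bar>g j t\<bar> \<le> K"
      using hv_node_residual_le[OF c6 M h(1), of "y j t"] hv_cell_residual_le[OF c6 M h(1), of "y j t"] lam
      by (simp_all add: f_def g_def K_def abs_mult)
    have "f (j + 1) t - f j t = - lam * hv_node_residual h d (y j t)"
      unfolding f_def y1 hv_node_residual_def d_def using h(1) by (simp add: field_simps)
    then show "\<bar>f (j + 1) t - f j t\<bar> \<le> h * K"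
      using hv_node_residual_le[OF d6 dM h(1), of "y j t"] lam by (simp add: K_def abs_mult mult_ac)
    have "g (j + 1) t - g j t = - lam * hv_cell_residual h d (y j t)"
      unfolding g_def y1 hv_cell_residual_def d_def using h(1) by (simp add: field_simps)
    then show "\<bar>g (j + 1) t - g j t\<bar> \<le> h * K"
      using hv_cell_residual_le[OF d6 dM h(1), of "y j t"] lam by (simp add: K_def abs_mult mult_ac)
  next
    fix j
    have Mh: "0 \<le> M * h ^ 4" using M0 h by simp
    have "\<bar>h ^ 4 / 180 * c 5 (y j 0)\<bar> \<le> M * h ^ 4"
      using mult_left_mono[OF M[of 5 "y j 0"], of "h ^ 4 / 180"] h Mh by (simp add: abs_mult mult_ac)
    then show "\<bar>a j 0\<bar> \<le> \<eta> + M * h ^ 4"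
      using v0(1)[of j] unfolding a_def y0 by linarith
    have "\<bar>h ^ 4 / 180 * (c 5 (y (j + 1) 0) - c 5 (y j 0))\<bar> \<le> h ^ 4 / 180 * (M * h)"
      unfolding abs_mult y1 using abs_diff_le_chain[OF c6, of 5 M "y j 0 + h" "y j 0"] M h
      by (intro mult_mono) auto
    also have "\<dots> \<le> h * (M * h ^ 4)"
      using mult_nonneg_nonneg[OF less_imp_le[OF h(1)] Mh] by (simp add: mult_ac)
    finally show "\<bar>a (j + 1) 0 - a j 0\<bar> \<le> h * (\<eta> + M * h ^ 4)"
      using v0(2)[of j] unfolding a_def y0 right_diff_distrib distrib_left by linarith
    show "\<bar>b j 0\<bar> \<le> \<eta> + M * h ^ 4" "\<bar>b (j + 1) 0 - b j 0\<bar> \<le> h * (\<eta> + M * h ^ 4)"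
      using vbar0(1)[of j] vbar0(2)[of j] Mh mult_nonneg_nonneg[OF less_imp_le[OF h(1)] Mh]
      unfolding b_def y0 distrib_left by linarith+
  qed
  have "\<bar>h ^ 4 / 180 * c 5 (y i T)\<bar> \<le> M * h ^ 4"
    using mult_left_mono[OF M[of 5 "y i T"], of "h ^ 4 / 180"] h M0 by (simp add: abs_mult mult_ac)
  with main show "\<bar>v i T - c 1 (node L N i - lam * T)\<bar> \<le> R + M * h ^ 4"
    unfolding a_def y_def by linarith
  show "\<bar>vbar i T - diff_quot h (c 0) (node L N i - lam * T)\<bar> \<le> R"
    using main by (simp add: b_def y_def)
qed

section \<open>Convergence\<close>

lemma Cp_real_derivative_chain:
  assumes p: "k \<le> p" and f: "Cp_real p f"
  shows "derivative_chain k (\<lambda>i. (deriv ^^ i) f)" "continuous_on UNIV ((deriv ^^ k) f)"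
proof -
  have d: "((deriv ^^ i) f has_real_derivative (deriv ^^ Suc i) f x) (at x)" if "i < p" for i x
    using f that by (simp add: Cp_real_def DERIV_deriv_iff_real_differentiable)
  then show "derivative_chain k (\<lambda>i. (deriv ^^ i) f)"
    using p by (simp add: derivative_chain_def)
  show "continuous_on UNIV ((deriv ^^ k) f)"
  proof (cases "k = p")
    case True
    then show ?thesis using f by (simp add: Cp_real_def)
  next
    case False
    then show ?thesis using d[of k] p by (meson DERIV_continuous_on le_neq_implies_less)
  qed
qed

lemma int_periodic_eqI:
  fixes x y :: "int \<Rightarrow> real"
  assumes N: "0 < N" and per: "\<And>j. x (j + int N) = x j" "\<And>j. y (j + int N) = y j"
    and eq: "\<And>j. j \<in> {0..<int N} \<Longrightarrow> x j = y j"
  shows "x j = y j"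
proof -
  have shift: "z (j + k * int N) = z j" if "\<And>j. z (j + int N) = z j" for z :: "int \<Rightarrow> real" and j k
  proof (induction k rule: int_induct[where k = 0])
    case base
    then show ?case by simp
  next
    case (step1 i)
    then show ?case using that[of "j + i * int N"] by (simp add: algebra_simps)
  next
    case (step2 i)
    then show ?case using that[of "j + (i - 1) * int N"] by (simp add: algebra_simps)
  qed
  have "x (j mod int N) = y (j mod int N)" using N by (intro eq) auto
  then show ?thesis
    using shift[of x "j mod int N" "j div int N"] shift[of y "j mod int N" "j div int N"] per by simp
qed

lemma diff_quot_bounds:
  assumes P: "\<And>x. (P has_real_derivative r x) (at x)" and h: "0 < h"
    and r: "\<And>x. \<bar>r x\<bar> \<le> \<eta>" "\<And>x y. \<bar>r x - r y\<bar> \<le> \<eta> * \<bar>x - y\<bar>"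
  shows "\<bar>diff_quot h P x\<bar> \<le> \<eta>" "\<bar>diff_quot h P x - diff_quot h P y\<bar> \<le> \<eta> * \<bar>x - y\<bar>"
proof -
  have "\<bar>P (x + h) - P x\<bar> \<le> \<eta> * h"
    using field_differentiable_bound[of UNIV P r \<eta> "x + h" x] P r(1) h by auto
  then show "\<bar>diff_quot h P x\<bar> \<le> \<eta>"
    using h by (simp add: diff_quot_def abs_divide field_simps)
  have "\<bar>diff_quot h r z\<bar> \<le> \<eta>" for z
    using r(2)[of "z + h" z] h by (simp add: diff_quot_def abs_divide field_simps)
  then show "\<bar>diff_quot h P x - diff_quot h P y\<bar> \<le> \<eta> * \<bar>x - y\<bar>"
    using field_differentiable_bound[of UNIV "diff_quot h P" "diff_quot h r" \<eta> x y]
      diff_quot_deriv[OF P] by auto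
qed

text \<open>Only cells within \<open>{0..L}\<close> are covered, since \<open>w\<close> is not assumed to be periodic.\<close>
lemma cell_average_advection:
  assumes L: "0 < L" and N: "0 < N"
    and w: "\<And>x. x \<in> {0..L} \<Longrightarrow> w x = f (x - s)"
    and F: "\<And>x. (F has_real_derivative f x) (at x)" and j: "j \<in> {0..<int N}"
  shows "cell_average L N w j = diff_quot (mesh L N) F (node L N j - s)"
proof -
  have h: "0 < mesh L N" using L N by (simp add: mesh_def)
  have 1: "0 \<le> node L N j" using j h by (simp add: node_def)
  have "node L N (j + 1) \<le> node L N (int N)"
    using j h by (auto simp: node_def intro!: mult_right_mono)
  also have "\<dots> = L" using N by (simp add: node_def mesh_def)
  finally have 2: "node L N (j + 1) \<le> L" .
  have "integral {node L N j..node L N (j + 1)} w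
      = integral {node L N j..node L N (j + 1)} (\<lambda>x. f (x - s))"
    using 1 2 by (intro integral_cong w) auto
  also have "\<dots> = F (node L N (j + 1) - s) - F (node L N j - s)"
  proof (rule integral_eq_antiderivative)
    show "((\<lambda>x. F (x - s)) has_real_derivative f (x - s)) (at x)" for x
      using iffD1[OF DERIV_shift, of F "f (x - s)" x "- s"] F[of "x - s"] by simp
    show "node L N j \<le> node L N (j + 1)" using h by (simp add: node_add_one)
  qed
  also have "node L N (j + 1) - s = node L N j - s + mesh L N" by (simp add: node_add_one)
  finally show ?thesis by (simp add: cell_average_def diff_quot_def)
qed

theorem theorem3p4:
  fixes L T lam :: real and w0 :: "real \<Rightarrow> real"
  assumes "L > 0" and "T > 0" and "lam > 0"
  shows "\<forall>\<epsilon>>0. \<exists>C>0. \<forall>p wstar N v vbar.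
    3 \<le> p \<longrightarrow>
    Cp_real p (periodic_ext L w0) \<longrightarrow>
    advection_solution L T lam w0 wstar \<longrightarrow>
    0 < N \<longrightarrow>
    hybrid_variable_solution L T lam N v vbar \<longrightarrow>
    exact_initial_data L N wstar v vbar \<longrightarrow>
      (\<forall>j\<in>{0..int N}.
         \<bar>v j T - wstar (node L N j) T\<bar> \<le> C * mesh L N ^ 4 + \<epsilon>) \<and>
      (\<forall>j\<in>{0..<int N}.
         \<bar>vbar j T - cell_average L N (\<lambda>x. wstar x T) j\<bar> \<le> C * mesh L N ^ 4 + \<epsilon>)"
proof (intro allI impI)
  fix \<epsilon> :: real assume \<epsilon>: "0 < \<epsilon>"
  show "\<exists>C>0. \<forall>p wstar N v vbar. 3 \<le> p \<longrightarrow> Cp_real p (periodic_ext L w0) \<longrightarrow>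
    advection_solution L T lam w0 wstar \<longrightarrow> 0 < N \<longrightarrow> hybrid_variable_solution L T lam N v vbar \<longrightarrow>
    exact_initial_data L N wstar v vbar \<longrightarrow>
      (\<forall>j\<in>{0..int N}. \<bar>v j T - wstar (node L N j) T\<bar> \<le> C * mesh L N ^ 4 + \<epsilon>) \<and>
      (\<forall>j\<in>{0..<int N}.
         \<bar>vbar j T - cell_average L N (\<lambda>x. wstar x T) j\<bar> \<le> C * mesh L N ^ 4 + \<epsilon>)"
  proof (cases "\<exists>p\<ge>3. Cp_real p (periodic_ext L w0)")
    case False
    then show ?thesis by (intro exI[of _ 1]) auto
  next
    case True
    \<comment> \<open>\<open>A\<close> is the stability constant; the initial error of size \<open>\<eta>\<close> contributes \<open>A * \<eta>\<close>,
      and replacing the exact solution by the smoothed one contributes another \<open>\<eta>\<close>.\<close>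
    define A where "A = sqrt (31 * exp T) * (1 + L)"
    have A: "0 \<le> A" using assms(1) by (simp add: A_def)
    define \<eta> where "\<eta> = \<epsilon> / (A + 1)"
    have \<eta>: "0 < \<eta>" "(A + 1) * \<eta> = \<epsilon>" using \<epsilon> A by (simp_all add: \<eta>_def)
    define f where "f = periodic_ext L w0"
    have perf: "f (x + L) = f x" for x using periodic_ext_add[OF assms(1)] by (simp add: f_def)
    have chf: "derivative_chain 3 (\<lambda>i. (deriv ^^ i) f)" "continuous_on UNIV ((deriv ^^ 3) f)"
      using True Cp_real_derivative_chain[of 3 _ f] unfolding f_def by blast+
    obtain c M where c: "derivative_chain 7 c" "\<And>x. c 1 (x + L) = c 1 x"
        "\<And>k x. k \<in> {5, 6, 7} \<Longrightarrow> \<bar>c k x\<bar> \<le> M"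
      and near: "\<And>x. \<bar>f x - c 1 x\<bar> \<le> \<eta>"
        "\<And>x y. \<bar>(f x - c 1 x) - (f y - c 1 y)\<bar> \<le> \<eta> * \<bar>x - y\<bar>"
      using smooth_periodic_approximation[OF assms(1) \<eta>(1), of "\<lambda>i. (deriv ^^ i) f"] chf perf
      by auto
    have "(f has_real_derivative deriv f x) (at x)" for x
      using chf(1) by (force simp: derivative_chain_def)
    then have "continuous_on UNIV f" by (meson DERIV_continuous_on)
    then obtain F where F: "\<And>x. (F has_real_derivative f x) (at x)"
      using continuous_antiderivative by blast
    have M: "0 \<le> M" using c(3)[of 5 0] by (auto intro: order_trans[OF abs_ge_zero])
    define C where "C = A * (M + sqrt T * (lam * M)) + M + 1"
    have C: "0 < C" using A M assms(2,3) by (simp add: C_def add_nonneg_pos)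
    have goal: "(\<forall>j\<in>{0..int N}. \<bar>v j T - w (node L N j) T\<bar> \<le> C * mesh L N ^ 4 + \<epsilon>) \<and>
      (\<forall>j\<in>{0..<int N}. \<bar>vbar j T - cell_average L N (\<lambda>x. w x T) j\<bar> \<le> C * mesh L N ^ 4 + \<epsilon>)"
      if w: "advection_solution L T lam w0 w" and N: "0 < N"
        and hv: "hybrid_variable_solution L T lam N v vbar" and init: "exact_initial_data L N w v vbar"
      for w N v vbar
    proof -
      define h where "h = mesh L N"
      have h: "0 < h" using assms(1) N by (simp add: h_def mesh_def)
      have T0: "0 \<in> {0..T}" "T \<in> {0..T}" using assms(2) by auto
      note wf = advection_solution_eq[OF assms w, folded f_def]
      have node_mem: "node L N j \<in> {0..L}" if "j \<in> {0..int N}" for j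
        using that h N assms(1) by (auto simp: node_def mesh_def field_simps mult_left_mono)
      have avg: "cell_average L N (\<lambda>x. w x t) j = diff_quot h F (node L N j - lam * t)"
        if "t \<in> {0..T}" "j \<in> {0..<int N}" for t j
        unfolding h_def
        by (rule cell_average_advection[OF assms(1) N _ F that(2)]) (rule wf[OF _ that(1)])
      have perv: "v (j + int N) t = v j t" "vbar (j + int N) t = vbar j t" if "t \<in> {0..T}" for j t
        using hv that unfolding hybrid_variable_solution_def by blast+
      have dqF: "diff_quot h F (x + L) = diff_quot h F x" for x
        using periodic_steklov[of f L h x, OF perf] steklov_eq_diff_quot[OF F h] by simp
      have v0: "v j 0 = f (node L N j)" for j
      proof (rule int_periodic_eqI[OF N, of "\<lambda>j. v j 0"])
        fix j assume "j \<in> {0..<int N}"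
        then show "v j 0 = f (node L N j)"
          using init wf[OF node_mem T0(1), of j] by (simp add: exact_initial_data_def)
      qed (simp_all add: perv[OF T0(1)] node_add_period[OF N] perf)
      have vbar0: "vbar j 0 = diff_quot h F (node L N j)" for j
      proof (rule int_periodic_eqI[OF N, of "\<lambda>j. vbar j 0"])
        fix j assume "j \<in> {0..<int N}"
        then show "vbar j 0 = diff_quot h F (node L N j)"
          using init avg[OF T0(1), of j] by (simp add: exact_initial_data_def)
      qed (simp_all add: perv[OF T0(1)] node_add_period[OF N] dqF)
      have "((\<lambda>x. F x - c 0 x) has_real_derivative f x - c 1 x) (at x)" for x
        using F c(1) by (auto intro!: DERIV_diff simp: derivative_chain_def)
      note dq = diff_quot_bounds[OF this h near]
      have dq_eq: "diff_quot h (\<lambda>x. F x - c 0 x) x = diff_quot h F x - diff_quot h (c 0) x" for x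
        by (simp add: diff_quot_def diff_divide_distrib)
      have bound: "\<bar>v i T - c 1 (node L N i - lam * T)\<bar>
           \<le> A * ((\<eta> + M * h ^ 4) + sqrt T * (lam * (M * h ^ 4))) + M * h ^ 4"
        "\<bar>vbar i T - diff_quot h (c 0) (node L N i - lam * T)\<bar>
           \<le> A * ((\<eta> + M * h ^ 4) + sqrt T * (lam * (M * h ^ 4)))"
        if "i \<in> {0..<int N}" for i
      proof -
        have "\<bar>v j 0 - c 1 (node L N j)\<bar> \<le> \<eta>" for j
          using near(1) by (simp add: v0)
        moreover have "\<bar>(v (j + 1) 0 - c 1 (node L N (j + 1))) - (v j 0 - c 1 (node L N j))\<bar> \<le> h * \<eta>" for j
          using near(2)[of "node L N (j + 1)" "node L N j"] h
          by (simp add: v0 node_add_one h_def mult.commute)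
        moreover have "\<bar>vbar j 0 - diff_quot h (c 0) (node L N j)\<bar> \<le> \<eta>" for j
          using dq(1)[of "node L N j"] by (simp add: vbar0 dq_eq)
        moreover have "\<bar>(vbar (j + 1) 0 - diff_quot h (c 0) (node L N (j + 1)))
           - (vbar j 0 - diff_quot h (c 0) (node L N j))\<bar> \<le> h * \<eta>" for j
          using dq(2)[of "node L N (j + 1)" "node L N j"] h unfolding vbar0 dq_eq
          by (simp add: node_add_one h_def mult.commute)
        ultimately show "\<bar>v i T - c 1 (node L N i - lam * T)\<bar>
           \<le> A * ((\<eta> + M * h ^ 4) + sqrt T * (lam * (M * h ^ 4))) + M * h ^ 4"
        "\<bar>vbar i T - diff_quot h (c 0) (node L N i - lam * T)\<bar>
           \<le> A * ((\<eta> + M * h ^ 4) + sqrt T * (lam * (M * h ^ 4)))"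
          using hv_error_bound[OF assms N c hv, of \<eta> i] that unfolding h_def A_def by blast+
      qed
      have R: "A * ((\<eta> + M * h ^ 4) + sqrt T * (lam * (M * h ^ 4))) + M * h ^ 4 + \<eta> \<le> C * h ^ 4 + \<epsilon>"
        using h unfolding \<eta>(2)[symmetric] C_def by (simp add: algebra_simps)
      have Mh: "0 \<le> M * h ^ 4" using M h by simp
      have nodal: "\<bar>v i T - f (node L N i - lam * T)\<bar> \<le> C * h ^ 4 + \<epsilon>" if "i \<in> {0..<int N}" for i
        using bound(1)[OF that] near(1)[of "node L N i - lam * T"] R by linarith
      have "\<bar>v j T - w (node L N j) T\<bar> \<le> C * h ^ 4 + \<epsilon>" if j: "j \<in> {0..int N}" for j
      proof (cases "j = int N")
        case False
        then show ?thesis using nodal[of j] wf[OF node_mem[OF j] T0(2)] j by simp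
      next
        case True
        then have "v j T = v 0 T" "f (node L N j - lam * T) = f (node L N 0 - lam * T)"
          using perv(1)[OF T0(2), of 0] node_add_period[OF N, of L 0] perf[of "node L N 0 - lam * T"]
          by (simp_all add: algebra_simps)
        then show ?thesis using nodal[of 0] wf[OF node_mem[OF j] T0(2)] N by simp
      qed
      moreover have "\<bar>vbar j T - cell_average L N (\<lambda>x. w x T) j\<bar> \<le> C * h ^ 4 + \<epsilon>"
        if j: "j \<in> {0..<int N}" for j
        using bound(2)[OF j] dq(1)[of "node L N j - lam * T"] R Mh
        unfolding avg[OF T0(2) j] dq_eq by linarith
      ultimately show ?thesis by (simp add: h_def)
    qed
    show ?thesis using C goal by blast
  qed
qed

end
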